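(* Let $F$ be a non-archimedean local field with ring of integers $\mathcal O$, uniformizer $\varpi$, and residue field of characteristic $p\neq 2$. Fix $\epsilon\in\mathcal O^\times$ which is not a square. A set of representatives of conjugacy classes of $GL(2,\mathcal O)$ is given by: \begin{itemize} \item $I_\alpha=\begin{pmatrix}\alpha&0\\0&\alpha\end{pmatrix}$, $\alpha\in\mathcal O^\times$ (scalar class); \item $B_{i,\alpha,\beta}=\begin{pmatrix}\alpha&\varpi^{i+1}\beta\\ \varpi^i&\alpha\end{pmatrix}$, $i\in\mathbb N$, $\alpha\in\mathcal O^\times$, $\beta\in\mathcal O$ (unipotent class); \item $C_{i,\alpha,\beta}=\begin{pmatrix}\alpha&\varpi^i\epsilon\beta\\ \varpi^i\beta&\alpha\end{pmatrix}$, $i\in\mathbb N$, $\alpha\in\mathcal O$, $\beta\in\mathcal O^\times$, $\alpha^2-\epsilon\beta^2\varpi^{2i}\in\mathcal O^\times$ (elliptic class); \item $D_{i,\alpha,\delta}=\begin{pmatrix}\alpha&0\\0&\delta\end{pmatrix}$, $i\in\mathbb N$, $\alpha\in\mathcal O^\times$, $\delta\in\mathcal O^\times$, $\alpha-\delta\in\varpi^i\mathcal O^\times$ (diagonal class). \end{itemize}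
   Context: $\mathbb N=\{0,1,2,\dots\}$.
   Formalization: The list is not irredundant: C_{i,α,β} is conjugate to C_{i,α,−β}, and D_{i,α,δ} to D_{i,δ,α}. What is proved: every class contains a listed matrix, and two listed matrices are conjugate exactly when they are equal or related in one of these two ways. *)

theory Defs
  imports "HOL-Analysis.Analysis"
begin

section \<open>Non-archimedean local fields\<close>

definition integers :: "('a::field \<Rightarrow> real) \<Rightarrow> 'a set" where
  "integers v = {x. v x \<le> 1}"

definition maximal_ideal :: "('a::field \<Rightarrow> real) \<Rightarrow> 'a set" where
  "maximal_ideal v = {x. v x < 1}"

definition integer_units :: "('a::field \<Rightarrow> real) \<Rightarrow> 'a set" where
  "integer_units v = {x \<in> integers v. \<exists>y \<in> integers v. x * y = 1}"

definition residue_field :: "('a::field \<Rightarrow> real) \<Rightarrow> 'a set set" where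
  "residue_field v =
     integers v // {(x, y). x \<in> integers v \<and> y \<in> integers v \<and> x - y \<in> maximal_ideal v}"

text \<open>A field, complete with respect to a non-archimedean absolute value whose value group is
  infinite cyclic, with finite residue field. The characteristic of the field is arbitrary.\<close>

locale nonarch_local_field =
  fixes v :: "'a::field \<Rightarrow> real"
  assumes nonneg: "0 \<le> v x"
    and eq_0_iff: "v x = 0 \<longleftrightarrow> x = 0"
    and mult: "v (x * y) = v x * v y"
    and ultrametric: "v (x + y) \<le> max (v x) (v y)"
    and discrete: "\<exists>c>1. v ` (UNIV - {0}) = range (\<lambda>k::int. c powi k)"
    and complete: "Metric_space.mcomplete UNIV (\<lambda>x y. v (x - y))"
    and finite_residue_field: "finite (residue_field v)"

text \<open>The least positive \<open>n\<close> with \<open>n \<cdot> 1 = 0\<close> in the residue field; it exists as soon as the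
  residue field is finite.\<close>

definition residue_char :: "('a::field \<Rightarrow> real) \<Rightarrow> nat" where
  "residue_char v = (LEAST n. 0 < n \<and> of_nat n \<in> maximal_ideal v)"

definition uniformizer :: "('a::field \<Rightarrow> real) \<Rightarrow> 'a \<Rightarrow> bool" where
  "uniformizer v \<pi> \<longleftrightarrow> maximal_ideal v = {\<pi> * x | x. x \<in> integers v}"

section \<open>Conjugacy in the general linear group over the ring of integers\<close>

definition GL2_integers :: "('a::field \<Rightarrow> real) \<Rightarrow> ('a^2^2) set" where
  "GL2_integers v = {A. (\<forall>i j. A $ i $ j \<in> integers v) \<and>
     (\<exists>B. (\<forall>i j. B $ i $ j \<in> integers v) \<and> A ** B = mat 1 \<and> B ** A = mat 1)}"

definition conj_rel :: "('a::field \<Rightarrow> real) \<Rightarrow> (('a^2^2) \<times> ('a^2^2)) set" where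
  "conj_rel v = {(A, B). A \<in> GL2_integers v \<and> B \<in> GL2_integers v \<and>
     (\<exists>P \<in> GL2_integers v. B = P ** A ** matrix_inv P)}"

definition conj_classes :: "('a::field \<Rightarrow> real) \<Rightarrow> ('a^2^2) set set" where
  "conj_classes v = GL2_integers v // conj_rel v"

section \<open>The four families\<close>

definition mat2 :: "'a::zero \<Rightarrow> 'a \<Rightarrow> 'a \<Rightarrow> 'a \<Rightarrow> 'a^2^2" where
  "mat2 a b c d = vector [vector [a, b], vector [c, d]]"

definition I_mat :: "'a::field \<Rightarrow> 'a^2^2" where
  "I_mat \<alpha> = mat2 \<alpha> 0 0 \<alpha>"

definition B_mat :: "'a::field \<Rightarrow> nat \<Rightarrow> 'a \<Rightarrow> 'a \<Rightarrow> 'a^2^2" where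
  "B_mat \<pi> i \<alpha> \<beta> = mat2 \<alpha> (\<pi> ^ (i + 1) * \<beta>) (\<pi> ^ i) \<alpha>"

definition C_mat :: "'a::field \<Rightarrow> 'a \<Rightarrow> nat \<Rightarrow> 'a \<Rightarrow> 'a \<Rightarrow> 'a^2^2" where
  "C_mat \<pi> \<epsilon> i \<alpha> \<beta> = mat2 \<alpha> (\<pi> ^ i * \<epsilon> * \<beta>) (\<pi> ^ i * \<beta>) \<alpha>"

definition D_mat :: "'a::field \<Rightarrow> 'a \<Rightarrow> 'a^2^2" where
  "D_mat \<alpha> \<delta> = mat2 \<alpha> 0 0 \<delta>"

definition scalar_reps :: "('a::field \<Rightarrow> real) \<Rightarrow> ('a^2^2) set" where
  "scalar_reps v = {I_mat \<alpha> | \<alpha>. \<alpha> \<in> integer_units v}"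

definition unipotent_reps :: "('a::field \<Rightarrow> real) \<Rightarrow> 'a \<Rightarrow> ('a^2^2) set" where
  "unipotent_reps v \<pi> =
     {B_mat \<pi> i \<alpha> \<beta> | i \<alpha> \<beta>. \<alpha> \<in> integer_units v \<and> \<beta> \<in> integers v}"

definition elliptic_param :: "('a::field \<Rightarrow> real) \<Rightarrow> 'a \<Rightarrow> 'a \<Rightarrow> nat \<Rightarrow> 'a \<Rightarrow> 'a \<Rightarrow> bool" where
  "elliptic_param v \<pi> \<epsilon> i \<alpha> \<beta> \<longleftrightarrow> \<alpha> \<in> integers v \<and> \<beta> \<in> integer_units v \<and>
     \<alpha>^2 - \<epsilon> * \<beta>^2 * \<pi> ^ (2 * i) \<in> integer_units v"

definition elliptic_reps :: "('a::field \<Rightarrow> real) \<Rightarrow> 'a \<Rightarrow> 'a \<Rightarrow> ('a^2^2) set" where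
  "elliptic_reps v \<pi> \<epsilon> = {C_mat \<pi> \<epsilon> i \<alpha> \<beta> | i \<alpha> \<beta>. elliptic_param v \<pi> \<epsilon> i \<alpha> \<beta>}"

definition diagonal_param :: "('a::field \<Rightarrow> real) \<Rightarrow> 'a \<Rightarrow> nat \<Rightarrow> 'a \<Rightarrow> 'a \<Rightarrow> bool" where
  "diagonal_param v \<pi> i \<alpha> \<delta> \<longleftrightarrow> \<alpha> \<in> integer_units v \<and> \<delta> \<in> integer_units v \<and>
     (\<exists>u \<in> integer_units v. \<alpha> - \<delta> = \<pi> ^ i * u)"

definition diagonal_reps :: "('a::field \<Rightarrow> real) \<Rightarrow> 'a \<Rightarrow> ('a^2^2) set" where
  "diagonal_reps v \<pi> = {D_mat \<alpha> \<delta> | i \<alpha> \<delta>. diagonal_param v \<pi> i \<alpha> \<delta>}"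

definition conj_reps :: "('a::field \<Rightarrow> real) \<Rightarrow> 'a \<Rightarrow> 'a \<Rightarrow> ('a^2^2) set" where
  "conj_reps v \<pi> \<epsilon> =
     scalar_reps v \<union> unipotent_reps v \<pi> \<union> elliptic_reps v \<pi> \<epsilon> \<union> diagonal_reps v \<pi>"

text \<open>The listed matrices are not literally pairwise non-conjugate: conjugating by
  \<open>diag(1, -1)\<close> changes the sign of \<open>\<beta>\<close> in the elliptic family, and conjugating by the
  permutation matrix swaps the entries in the diagonal family. The following relation on the list
  consists of equality and exactly these coincidences.\<close>

definition same_up_to_symmetry ::
    "('a::field \<Rightarrow> real) \<Rightarrow> 'a \<Rightarrow> 'a \<Rightarrow> 'a^2^2 \<Rightarrow> 'a^2^2 \<Rightarrow> bool" where
  "same_up_to_symmetry v \<pi> \<epsilon> M N \<longleftrightarrow> M = N \<or>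
     (\<exists>i \<alpha> \<beta>. elliptic_param v \<pi> \<epsilon> i \<alpha> \<beta> \<and> M = C_mat \<pi> \<epsilon> i \<alpha> \<beta> \<and> N = C_mat \<pi> \<epsilon> i \<alpha> (- \<beta>)) \<or>
     (\<exists>i \<alpha> \<delta>. diagonal_param v \<pi> i \<alpha> \<delta> \<and> M = D_mat \<alpha> \<delta> \<and> N = D_mat \<delta> \<alpha>)"

end

theory Submission
  imports Defs
begin

text \<open>A matrix over \<open>\<O>\<close> that is not scalar can be written \<open>\<alpha> + \<pi>\<^sup>i X\<close> with \<open>X\<close> traceless and not
  divisible by \<open>\<pi>\<close>, because \<open>2\<close> is a unit: \<open>\<alpha>\<close> is half the trace and \<open>\<pi>\<^sup>i\<close> the greatest common
  divisor of the entries of the traceless part. Modulo \<open>\<pi>\<close> the matrix \<open>X\<close> is nonzero and traceless,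
  hence not scalar, hence cyclic. So there is a vector \<open>w\<close> such that \<open>w\<close> and \<open>X w\<close> form a
  basis of \<open>\<O>\<^sup>2\<close>, and as \<open>X\<^sup>2 = \<Delta>\<close> for a scalar \<open>\<Delta> \<in> \<O>\<close>, the matrix of \<open>X\<close> in this basis depends
  only on \<open>\<Delta>\<close>. Thus the triple \<open>(\<alpha>, i, \<Delta>)\<close> determines the conjugacy class; it is also an
  invariant of the class, because conjugation preserves the trace, the determinant
  \<open>\<alpha>\<^sup>2 - \<pi>\<^sup>2\<^sup>i \<Delta>\<close> and the divisibility by powers of \<open>\<pi>\<close>. This is \<open>conj_iff_same_invariants\<close>.

  It remains to see which member of the list has given invariants. Exactly one of the following
  holds: \<open>\<Delta> = \<pi> \<beta>\<close> with \<open>\<beta> \<in> \<O>\<close>, \<open>\<Delta> = \<epsilon> \<beta>\<^sup>2\<close> with \<open>\<beta>\<close> a unit, or \<open>\<Delta> = s\<^sup>2\<close> with \<open>s\<close> a unit. The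
  matrices of the list with these values of \<open>\<Delta>\<close> are, respectively, unipotent, elliptic, and diagonal
  with entries \<open>\<alpha> \<plusminus> \<pi>\<^sup>i s\<close>. The unit \<open>\<beta>\<close> or \<open>s\<close> is determined up to sign, which accounts for the
  coincidences in the list. That every unit is a square or \<open>\<epsilon>\<close> times a square,
  \<open>unit_square_or_nonsquare_times_square\<close>, follows by counting squares in the finite residue field and
  lifting square roots by completeness.\<close>

section \<open>The absolute value\<close>

context nonarch_local_field
begin

lemma v_0 [simp]: "v 0 = 0"
  by (simp add: eq_0_iff)

lemma v_1 [simp]: "v 1 = 1"
proof -
  have "v 1 * v 1 = v 1" "v 1 \<noteq> 0"
    using mult[of 1 1] eq_0_iff[of 1] by simp_all
  then show ?thesis by simp
qed

lemma v_minus [simp]: "v (- x) = v x"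
proof -
  have "v (- 1) * v (- 1) = 1"
    using mult[of "- 1" "- 1"] by simp
  then have "v (- 1) = 1"
    using nonneg[of "- 1"] by (metis abs_of_nonneg abs_square_eq_1 power2_eq_square)
  then show ?thesis
    using mult[of "- 1" x] by simp
qed

lemma v_minus_commute: "v (x - y) = v (y - x)"
  by (metis minus_diff_eq v_minus)

lemma v_power: "v (x ^ n) = v x ^ n"
  by (induction n) (simp_all add: mult)

lemma v_divide: "v (x / y) = v x / v y"
proof (cases "y = 0")
  case False
  then have "v (x / y) * v y = v x" "v y \<noteq> 0"
    using mult[of "x / y" y] eq_0_iff[of y] by simp_all
  then show ?thesis by (simp add: field_simps)
qed simp

lemma v_add_le: "v x \<le> r \<Longrightarrow> v y \<le> r \<Longrightarrow> v (x + y) \<le> r"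
  using ultrametric[of x y] by simp

lemma v_diff_le: "v x \<le> r \<Longrightarrow> v y \<le> r \<Longrightarrow> v (x - y) \<le> r"
  using v_add_le[of x r "- y"] by simp

lemma v_add_less: "v x < r \<Longrightarrow> v y < r \<Longrightarrow> v (x + y) < r"
  using ultrametric[of x y] by simp

lemma v_diff_less: "v x < r \<Longrightarrow> v y < r \<Longrightarrow> v (x - y) < r"
  using v_add_less[of x r "- y"] by simp

lemma v_add_dominant: "v y < v x \<Longrightarrow> v (x + y) = v x"
  using ultrametric[of x y] ultrametric[of "x + y" "- y"] by auto

lemma v_mult_le_1: "v x \<le> 1 \<Longrightarrow> v y \<le> 1 \<Longrightarrow> v (x * y) \<le> 1"
  by (simp add: mult mult_le_one nonneg)

lemma v_mult_less_1: "v x < 1 \<Longrightarrow> v y \<le> 1 \<Longrightarrow> v (x * y) < 1"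
  using mult_left_le[of "v y" "v x"] nonneg[of x] by (simp add: mult)

lemma v_eq_1_of_mult: "v x \<le> 1 \<Longrightarrow> v y \<le> 1 \<Longrightarrow> v (x * y) = 1 \<Longrightarrow> v x = 1"
  using v_mult_less_1[of x y] by fastforce

lemma mem_integers: "x \<in> integers v \<longleftrightarrow> v x \<le> 1"
  by (simp add: integers_def)

lemma mem_integer_units: "x \<in> integer_units v \<longleftrightarrow> v x = 1"
proof
  assume "x \<in> integer_units v"
  then show "v x = 1"
    using v_eq_1_of_mult by (auto simp: integer_units_def integers_def)
next
  assume "v x = 1"
  moreover from this have "x * (1 / x) = 1" "v (1 / x) = 1"
    using eq_0_iff[of x] by (auto simp: v_divide)
  ultimately show "x \<in> integer_units v"
    by (auto simp: integer_units_def mem_integers intro!: bexI[of _ "1 / x"])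
qed

end

text \<open>Odd residue characteristic enters only through the fact that \<open>2\<close> is a unit.\<close>

locale odd_local_field = nonarch_local_field v
  for v :: "'a::field \<Rightarrow> real" +
  fixes \<pi> :: 'a
  assumes uniformizer: "uniformizer v \<pi>"
    and odd: "residue_char v \<noteq> 2"
begin

lemma v_2 [simp]: "v 2 = 1"
proof (rule ccontr)
  \<comment> \<open>Otherwise \<open>2\<close>, but not \<open>1\<close>, lies in the maximal ideal, and the residue characteristic is \<open>2\<close>.\<close>
  assume "v 2 \<noteq> 1"
  then have lt: "v 2 < 1"
    using v_add_le[of 1 1 1] by simp
  have "(LEAST n. 0 < n \<and> of_nat n \<in> maximal_ideal v) = 2"
  proof (rule Least_equality)
    show "0 < (2::nat) \<and> of_nat 2 \<in> maximal_ideal v"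
      using lt by (simp add: maximal_ideal_def)
    fix n :: nat
    assume n: "0 < n \<and> of_nat n \<in> maximal_ideal v"
    then have "n \<noteq> 1" by (auto simp: maximal_ideal_def)
    with n show "2 \<le> n" by linarith
  qed
  with odd show False by (simp add: residue_char_def)
qed

lemma two_neq_0 [simp]: "(2::'a) \<noteq> 0"
  using eq_0_iff[of 2] v_2 by auto

lemma v_uniformizer_less_1: "v \<pi> < 1"
proof -
  have "\<pi> * 1 \<in> maximal_ideal v"
    using uniformizer unfolding uniformizer_def by (auto simp: integers_def intro!: exI[of _ 1])
  then show ?thesis by (simp add: maximal_ideal_def)
qed

lemma uniformizer_dvd:
  assumes "v x < 1"
  obtains y where "x = \<pi> * y" "v y \<le> 1"
  using assms uniformizer by (auto simp: uniformizer_def maximal_ideal_def integers_def)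

lemma uniformizer_neq_0 [simp]: "\<pi> \<noteq> 0"
proof
  \<comment> \<open>Otherwise the maximal ideal is zero, but the value group contains \<open>1 / c < 1\<close>.\<close>
  assume "\<pi> = 0"
  then have small: "x = 0" if "v x < 1" for x
    using uniformizer_dvd[OF that] by auto
  obtain c :: real where c: "c > 1" "v ` (UNIV - {0}) = range (\<lambda>k::int. c powi k)"
    using discrete by (elim exE conjE) (rule that)
  have "c powi (- 1) \<in> v ` (UNIV - {0})" unfolding c(2) by (rule rangeI)
  then obtain x where "x \<noteq> 0" "c powi (- 1) = v x" by (rule imageE) simp
  moreover have "c powi (- 1) < 1"
    using c(1) by (simp add: power_int_minus inverse_eq_divide divide_less_eq)
  ultimately show False using small[of x] by simp
qed

lemma v_uniformizer_pos: "0 < v \<pi>"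
  using nonneg[of \<pi>] eq_0_iff[of \<pi>] by auto

lemma v_uniformizer_power_le_1: "v \<pi> ^ n \<le> 1"
  using v_uniformizer_less_1 v_uniformizer_pos by (simp add: power_le_one)

lemma v_uniformizer_power_le_iff: "v \<pi> ^ i \<le> v \<pi> ^ j \<longleftrightarrow> j \<le> i"
  using v_uniformizer_less_1 v_uniformizer_pos by simp

lemma uniformizer_factorization:
  assumes "v x \<le> 1" "x \<noteq> 0"
  obtains n u where "x = \<pi> ^ n * u" "v u = 1"
proof -
  have "0 < v x"
    using assms nonneg[of x] eq_0_iff[of x] by auto
  then have ex: "\<exists>n. v \<pi> ^ n < v x"
    using real_arch_pow_inv v_uniformizer_less_1 by blast
  define m where "m = (LEAST n. v \<pi> ^ n < v x)"
  have m: "v \<pi> ^ m < v x"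
    unfolding m_def using ex by (rule LeastI_ex)
  with assms have "m \<noteq> 0" by (intro notI) simp
  then obtain n where n: "m = Suc n" by (cases m) auto
  have le: "v x \<le> v \<pi> ^ n"
    using not_less_Least[of n "\<lambda>n. v \<pi> ^ n < v x"] n by (force simp: m_def)
  define u where "u = x / \<pi> ^ n"
  have x: "x = \<pi> ^ n * u" by (simp add: u_def)
  have "v u \<le> 1"
    using le v_uniformizer_pos by (simp add: u_def v_divide v_power divide_le_eq)
  moreover have "\<not> v u < 1"
  proof
    assume "v u < 1"
    then obtain y where "u = \<pi> * y" "v y \<le> 1" by (rule uniformizer_dvd)
    then have "v x \<le> v \<pi> ^ m"
      using v_uniformizer_pos by (simp add: x n mult v_power mult_left_le)
    with m show False by simp
  qed
  ultimately have "v u = 1" by simp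
  with x that show ?thesis by blast
qed

section \<open>Squares of units\<close>

text \<open>Newton's iteration for \<open>t\<^sup>2 = w\<close> from \<open>t = 1\<close>, with the derivative kept at its initial
  value \<open>2\<close>. Writing \<open>r = v (w - 1)\<close>, each step multiplies the error by \<open>1 - t\<close>, of size at most
  \<open>r\<close>, up to a quadratic term, so that linear convergence already follows.\<close>

lemma square_root_near_1:
  assumes w: "v (w - 1) < 1"
  obtains t where "t\<^sup>2 = w" "v t \<le> 1"
proof -
  define r where "r = v (w - 1)"
  have r: "0 \<le> r" "r < 1" using w nonneg by (simp_all add: r_def)
  define s where "s = rec_nat 1 (\<lambda>_ t. t - (t\<^sup>2 - w) / 2)"
  have s_0: "s 0 = 1" and s_Suc: "s (Suc n) = s n - ((s n)\<^sup>2 - w) / 2" for n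
    by (simp_all add: s_def)
  have bounds: "v (s n - 1) \<le> r \<and> v ((s n)\<^sup>2 - w) \<le> r ^ Suc n" for n
  proof (induction n)
    case 0
    then show ?case using r by (simp add: s_0 r_def v_minus_commute)
  next
    case (Suc n)
    define d where "d = ((s n)\<^sup>2 - w) / 2"
    have d: "v d \<le> r ^ Suc n" using Suc by (simp add: d_def v_divide)
    have d': "v d \<le> r"
      using d power_decreasing[of 1 "Suc n" r] r by simp
    have "v (s (Suc n) - 1) \<le> r"
      using v_diff_le[of "s n - 1" r d] Suc d' by (simp add: s_Suc d_def algebra_simps)
    moreover
    have "(s n)\<^sup>2 - w = 2 * d" by (simp add: d_def)
    then have "(s (Suc n))\<^sup>2 - w = ((s n)\<^sup>2 - w) * (1 - s n) + d * d"
      unfolding s_Suc d_def[symmetric] by algebra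
    moreover have "v (((s n)\<^sup>2 - w) * (1 - s n)) \<le> r ^ Suc n * r"
      unfolding mult using Suc r by (intro mult_mono) (simp_all add: nonneg v_minus_commute)
    moreover have "v (d * d) \<le> r ^ Suc n * r"
      unfolding mult using d d' r by (intro mult_mono) (simp_all add: nonneg)
    ultimately show ?case
      using v_add_le[of "((s n)\<^sup>2 - w) * (1 - s n)" "r ^ Suc n * r" "d * d"]
      by (simp add: mult.commute mult.left_commute)
  qed
  have tail: "v (s (n + k) - s n) \<le> r ^ n" for n k
  proof (induction k)
    case (Suc k)
    have "v (((s (n + k))\<^sup>2 - w) / 2) \<le> r ^ Suc (n + k)"
      using bounds[of "n + k"] by (simp add: v_divide)
    also have "\<dots> \<le> r ^ n"
      using r by (intro power_decreasing) simp_all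
    finally show ?case
      using v_diff_le[OF Suc, of "((s (n + k))\<^sup>2 - w) / 2"]
      by (simp add: s_Suc diff_diff_eq add.commute)
  qed (use r in simp)
  interpret d: Metric_space UNIV "\<lambda>x y. v (x - y)"
  proof
    show "v (x - z) \<le> v (x - y) + v (y - z)" for x y z
      using ultrametric[of "x - y" "y - z"] nonneg[of "x - y"] nonneg[of "y - z"] by simp
  qed (simp_all add: nonneg eq_0_iff v_minus_commute)
  have tail': "v (s n - s m) \<le> r ^ N" if "N \<le> n" "N \<le> m" for n m N
    using tail[of N "n - N"] tail[of N "m - N"] that
      v_diff_le[of "s n - s N" "r ^ N" "s m - s N"] by simp
  have "d.MCauchy s"
    unfolding d.MCauchy_def
  proof (intro conjI allI impI)
    fix e :: real
    assume "e > 0"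
    then obtain N where "r ^ N < e" using real_arch_pow_inv r by blast
    then show "\<exists>N. \<forall>n n'. N \<le> n \<longrightarrow> N \<le> n' \<longrightarrow> v (s n - s n') < e"
      using tail' by (meson le_less_trans)
  qed simp
  then obtain t where t: "limitin d.mtopology s t sequentially"
    using complete unfolding d.mcomplete_def by blast
  have near: "\<exists>n\<ge>N. v (s n - t) < e" if "e > 0" for e N
  proof -
    have "eventually (\<lambda>n. v (s n - t) < e) sequentially"
      using t that by (simp add: d.limitin_metric)
    then show ?thesis
      unfolding eventually_sequentially by (meson nat_le_linear)
  qed
  have s_le: "v (s n) \<le> 1" for n
    using v_add_le[of "s n - 1" 1 1] bounds[of n] r by simp
  have t_le: "v t \<le> 1"
  proof -
    obtain n where "v (s n - t) < 1" using near[of 1] by auto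
    then show ?thesis using v_diff_le[of "s n" 1 "s n - t"] s_le by simp
  qed
  have "v (t\<^sup>2 - w) \<le> e" if e: "e > 0" for e
  proof -
    obtain N where N: "r ^ N < e" using real_arch_pow_inv r e by blast
    obtain n where n: "n \<ge> N" "v (s n - t) < e" using near e by blast
    have "v ((s n)\<^sup>2 - w) \<le> r ^ Suc n" using bounds by blast
    also have "\<dots> \<le> r ^ N" using n r by (intro power_decreasing) simp_all
    finally have 1: "v ((s n)\<^sup>2 - w) \<le> e" using N by simp
    have "v (s n + t) \<le> 1" using v_add_le s_le t_le by blast
    then have "v ((s n - t) * (s n + t)) \<le> e"
      using n(2) mult_mono[of "v (s n - t)" e "v (s n + t)" 1] nonneg e by (simp add: mult)
    moreover have "t\<^sup>2 - w = ((s n)\<^sup>2 - w) - (s n - t) * (s n + t)"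
      by algebra
    ultimately show ?thesis using 1 v_diff_le by metis
  qed
  then have "v (t\<^sup>2 - w) \<le> 0" by (rule field_le_epsilon[of _ 0, simplified])
  then have "t\<^sup>2 = w" using nonneg[of "t\<^sup>2 - w"] eq_0_iff[of "t\<^sup>2 - w"] by simp
  with t_le that show ?thesis by blast
qed

lemma square_root_lift:
  assumes "v u = 1" "v y = 1" "v (u - y\<^sup>2) < 1"
  obtains t where "t\<^sup>2 = u" "v t = 1"
proof -
  have y: "y \<noteq> 0" using assms by auto
  have "u / y\<^sup>2 - 1 = (u - y\<^sup>2) / y\<^sup>2" using y by (simp add: field_simps)
  then have "v (u / y\<^sup>2 - 1) < 1" using assms by (simp add: v_divide v_power)
  then obtain t where t: "t\<^sup>2 = u / y\<^sup>2" "v t \<le> 1" by (rule square_root_near_1)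
  have "(t * y)\<^sup>2 = u" using t y by (simp add: power_mult_distrib)
  moreover have "v (t * y) = 1"
    using calculation assms(1) nonneg[of "t * y"]
    by (metis abs_of_nonneg abs_square_eq_1 v_power)
  ultimately show ?thesis using that by blast
qed

text \<open>The same element of \<open>\<O>\<close> for all members of a residue class. Counting such representatives
  instead of the classes themselves keeps the arithmetic inside the field.\<close>

definition residue_rep :: "'a \<Rightarrow> 'a" where
  "residue_rep x = (SOME y. y \<in> {y. v y \<le> 1 \<and> v (x - y) < 1})"

lemma residue_rep:
  assumes "v x \<le> 1"
  shows "v (residue_rep x) \<le> 1" "v (x - residue_rep x) < 1"
proof -
  have "x \<in> {y. v y \<le> 1 \<and> v (x - y) < 1}" using assms by simp
  then have "residue_rep x \<in> {y. v y \<le> 1 \<and> v (x - y) < 1}"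
    unfolding residue_rep_def by (rule someI)
  then show "v (residue_rep x) \<le> 1" "v (x - residue_rep x) < 1" by auto
qed

lemma v_residue_rep_unit: "v x = 1 \<Longrightarrow> v (residue_rep x) = 1"
  using residue_rep[of x] v_add_dominant[of "residue_rep x - x" x]
  by (simp add: v_minus_commute)

lemma residue_rep_eq_iff:
  assumes "v x \<le> 1" "v y \<le> 1"
  shows "residue_rep x = residue_rep y \<longleftrightarrow> v (x - y) < 1"
proof
  assume "residue_rep x = residue_rep y"
  then show "v (x - y) < 1"
    using v_diff_less[OF residue_rep(2)[OF assms(1)] residue_rep(2)[OF assms(2)]] by simp
next
  assume xy: "v (x - y) < 1"
  then have yx: "v (y - x) < 1" by (simp add: v_minus_commute)
  have "v (x - z) < 1 \<longleftrightarrow> v (y - z) < 1" for z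
    using v_add_less[OF xy, of "y - z"] v_add_less[OF yx, of "x - z"] by auto
  then show "residue_rep x = residue_rep y" by (simp add: residue_rep_def)
qed

lemma finite_residue_reps: "finite (residue_rep ` {x. v x \<le> 1})"
proof -
  let ?E = "{(x, y). x \<in> integers v \<and> y \<in> integers v \<and> x - y \<in> maximal_ideal v}"
  have "residue_rep x \<in> (\<lambda>C. SOME y. y \<in> C) ` residue_field v" if "v x \<le> 1" for x
  proof -
    have "?E `` {x} \<in> residue_field v"
      unfolding residue_field_def by (rule quotientI) (use that in \<open>simp add: integers_def\<close>)
    moreover have "?E `` {x} = {y. v y \<le> 1 \<and> v (x - y) < 1}"
      using that by (auto simp: integers_def maximal_ideal_def)
    ultimately have "residue_rep x = (SOME y. y \<in> ?E `` {x})" by (simp add: residue_rep_def)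
    then show ?thesis by (rule image_eqI) fact
  qed
  then have "residue_rep ` {x. v x \<le> 1} \<subseteq> (\<lambda>C. SOME y. y \<in> C) ` residue_field v" by blast
  then show ?thesis using finite_residue_field finite_surj by blast
qed

text \<open>In the residue field the squaring map on nonzero elements is at most two-to-one, so at least
  half of these elements are squares. The multiples of the squares by a non-square \<open>\<epsilon>\<close> are as
  numerous and are non-squares, so that the two sets exhaust the nonzero residues. Square roots in
  the residue field lift to \<open>\<O>\<close>.\<close>

lemma unit_square_or_nonsquare_times_square:
  assumes eps: "v \<epsilon> = 1" "\<not> (\<exists>x. v x = 1 \<and> \<epsilon> = x\<^sup>2)" and u: "v u = 1"
  obtains s where "v s = 1" "u = s\<^sup>2" | \<beta> where "v \<beta> = 1" "u = \<epsilon> * \<beta>\<^sup>2"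
proof -
  define R where "R = residue_rep ` {x. v x = 1}"
  define q where "q = (\<lambda>x. residue_rep (x\<^sup>2))"
  define Q where "Q = q ` R"
  define E where "E = (\<lambda>y. residue_rep (\<epsilon> * y)) ` Q"
  have finR: "finite R"
    using finite_residue_reps by (rule finite_subset[rotated]) (auto simp: R_def)
  have R_unit: "v x = 1" if "x \<in> R" for x
    using that v_residue_rep_unit by (auto simp: R_def)
  have R_memI: "residue_rep x \<in> R" if "v x = 1" for x
    using that by (simp add: R_def)
  have R_fixed: "residue_rep x = x" if "x \<in> R" for x
  proof -
    obtain y where y: "x = residue_rep y" "v y = 1" using \<open>x \<in> R\<close> by (auto simp: R_def)
    then show ?thesis
      using residue_rep(2)[of y] R_unit[OF that] by (simp add: residue_rep_eq_iff v_minus_commute)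
  qed
  have QR: "Q \<subseteq> R"
  proof
    fix y
    assume "y \<in> Q"
    then obtain x where "x \<in> R" "y = residue_rep (x\<^sup>2)" unfolding Q_def q_def by (rule imageE)
    then show "y \<in> R" using R_unit[of x] R_memI by (simp add: v_power)
  qed
  have ER: "E \<subseteq> R"
  proof
    fix z
    assume "z \<in> E"
    then obtain y where "y \<in> Q" "z = residue_rep (\<epsilon> * y)" unfolding E_def by (rule imageE)
    moreover from this have "v y = 1" using QR R_unit by blast
    ultimately show "z \<in> R" using eps(1) R_memI by (simp add: mult)
  qed
  have fibre: "card {x \<in> R. q x = y} \<le> 2" for y
  proof (cases "\<exists>a \<in> R. q a = y")
    case True
    then obtain a where a: "a \<in> R" "q a = y" by blast
    have "x \<in> {a, residue_rep (- a)}" if x: "x \<in> R" "q x = y" for x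
    proof -
      have "v (x\<^sup>2 - a\<^sup>2) < 1"
        using x a R_unit residue_rep_eq_iff[of "x\<^sup>2" "a\<^sup>2"] by (simp add: q_def v_power)
      moreover have "x\<^sup>2 - a\<^sup>2 = (x - a) * (x + a)" by algebra
      ultimately have "\<not> (1 \<le> v (x - a) \<and> 1 \<le> v (x + a))"
        using mult_mono[of 1 "v (x - a)" 1 "v (x + a)"] by (auto simp: mult)
      then have "residue_rep x = residue_rep a \<or> residue_rep x = residue_rep (- a)"
        using x a R_unit by (auto simp: residue_rep_eq_iff)
      then show ?thesis using R_fixed x a by auto
    qed
    then have "{x \<in> R. q x = y} \<subseteq> {a, residue_rep (- a)}" by blast
    then have "card {x \<in> R. q x = y} \<le> card {a, residue_rep (- a)}"
      by (intro card_mono) auto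
    also have "\<dots> \<le> 2" by (simp add: card_insert_if)
    finally show ?thesis .
  next
    case False
    then have "{x \<in> R. q x = y} = {}" by auto
    then show ?thesis by (metis card.empty zero_le)
  qed
  have finQ: "finite Q" using finR by (simp add: Q_def)
  have "R = (\<Union>y\<in>Q. {x \<in> R. q x = y})" by (auto simp: Q_def)
  then have "card R \<le> (\<Sum>y\<in>Q. card {x \<in> R. q x = y})"
    using card_UN_le[OF finQ] by metis
  also have "\<dots> \<le> 2 * card Q"
    using sum_bounded_above[of Q "\<lambda>y. card {x \<in> R. q x = y}" 2] fibre by (simp add: mult.commute)
  finally have half: "card R \<le> 2 * card Q" .
  have "inj_on (\<lambda>y. residue_rep (\<epsilon> * y)) Q"
  proof (rule inj_onI)
    fix y z
    assume yz: "y \<in> Q" "z \<in> Q" "residue_rep (\<epsilon> * y) = residue_rep (\<epsilon> * z)"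
    then have units: "v y = 1" "v z = 1" using QR R_unit by auto
    then have "v (\<epsilon> * y - \<epsilon> * z) < 1"
      using yz eps(1) by (simp add: residue_rep_eq_iff mult)
    then have "v (y - z) < 1"
      using eps(1) mult[of \<epsilon> "y - z"] by (simp add: right_diff_distrib)
    then have "residue_rep y = residue_rep z"
      using units by (simp add: residue_rep_eq_iff)
    then show "y = z" using R_fixed yz QR by (metis subsetD)
  qed
  then have "card E = card Q" by (simp add: E_def card_image)
  moreover have "Q \<inter> E = {}"
  proof (rule ccontr)
    \<comment> \<open>A common residue of \<open>a\<^sup>2\<close> and \<open>\<epsilon> b\<^sup>2\<close> makes \<open>\<epsilon>\<close> congruent to the square of \<open>a / b\<close>.\<close>
    assume "Q \<inter> E \<noteq> {}"
    then obtain a b where ab: "a \<in> R" "b \<in> R" "q a = residue_rep (\<epsilon> * q b)"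
      by (auto simp: Q_def E_def)
    then have un: "v a = 1" "v b = 1" using R_unit by auto
    then have "v (q b) = 1" using v_residue_rep_unit by (simp add: q_def v_power)
    then have "v (a\<^sup>2 - \<epsilon> * q b) < 1"
      using ab un eps(1) residue_rep_eq_iff[of "a\<^sup>2" "\<epsilon> * q b"] by (simp add: q_def v_power mult)
    moreover have "v (\<epsilon> * (b\<^sup>2 - q b)) < 1"
      using residue_rep(2)[of "b\<^sup>2"] un eps(1) by (simp add: q_def v_power mult)
    moreover have "\<epsilon> * b\<^sup>2 - a\<^sup>2 = \<epsilon> * (b\<^sup>2 - q b) - (a\<^sup>2 - \<epsilon> * q b)" by algebra
    ultimately have lt: "v (\<epsilon> * b\<^sup>2 - a\<^sup>2) < 1"
      using v_diff_less by metis
    have b0: "b \<noteq> 0" using un by auto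
    have "\<epsilon> - (a / b)\<^sup>2 = (\<epsilon> * b\<^sup>2 - a\<^sup>2) / b\<^sup>2" using b0 by (simp add: field_simps)
    then have "v (\<epsilon> - (a / b)\<^sup>2) < 1" using lt un by (simp add: v_divide v_power)
    moreover have "v (a / b) = 1" using un by (simp add: v_divide)
    ultimately show False using square_root_lift[OF eps(1)] eps(2) by metis
  qed
  ultimately have "card (Q \<union> E) = 2 * card Q"
    using finQ by (simp add: card_Un_disjoint E_def)
  then have "Q \<union> E = R"
    using half QR ER finR by (intro card_seteq) auto
  moreover have "residue_rep u \<in> R" using u by (auto simp: R_def)
  ultimately consider "residue_rep u \<in> Q" | "residue_rep u \<in> E" by blast
  then show ?thesis
  proof cases
    case 1
    then obtain a where a: "a \<in> R" "residue_rep u = residue_rep (a\<^sup>2)"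
      by (auto simp: Q_def q_def)
    then have "v (u - a\<^sup>2) < 1"
      using u R_unit by (simp add: residue_rep_eq_iff v_power)
    then show ?thesis
      using square_root_lift[OF u R_unit[OF a(1)]] that(1) by metis
  next
    case 2
    then obtain a where a: "a \<in> R" "residue_rep u = residue_rep (\<epsilon> * q a)"
      by (auto simp: E_def Q_def)
    have un: "v a = 1" "v (q a) = 1"
      using a R_unit v_residue_rep_unit by (auto simp: q_def v_power)
    then have 1: "v (u - \<epsilon> * q a) < 1"
      using a u eps(1) by (simp add: residue_rep_eq_iff mult)
    have 2: "v (\<epsilon> * (a\<^sup>2 - q a)) < 1"
      using residue_rep(2)[of "a\<^sup>2"] un eps(1) by (simp add: q_def v_power mult)
    have e0: "\<epsilon> \<noteq> 0" using eps(1) by auto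
    have "u / \<epsilon> - a\<^sup>2 = ((u - \<epsilon> * q a) - \<epsilon> * (a\<^sup>2 - q a)) / \<epsilon>"
      using e0 by (simp add: field_simps)
    then have "v (u / \<epsilon> - a\<^sup>2) < 1"
      using v_diff_less[OF 1 2] eps(1) by (simp add: v_divide)
    moreover have "v (u / \<epsilon>) = 1" using u eps(1) by (simp add: v_divide)
    ultimately obtain t where "t\<^sup>2 = u / \<epsilon>" "v t = 1"
      using square_root_lift un(1) by metis
    then show ?thesis using that(2)[of t] e0 by simp
  qed
qed

section \<open>Two-by-two matrices over the ring of integers\<close>

lemma (in -) mat2_nth [simp]:
  "mat2 a b c d $ 1 $ 1 = a" "mat2 a b c d $ 1 $ 2 = b"
  "mat2 a b c d $ 2 $ 1 = c" "mat2 a b c d $ 2 $ 2 = d"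
  by (simp_all add: mat2_def)

lemma (in -) mat2_eq_iff [simp]:
  "mat2 a b c d = mat2 a' b' c' d' \<longleftrightarrow> a = a' \<and> b = b' \<and> c = c' \<and> d = d'"
  by (metis mat2_nth)

lemma (in -) mat2_cases [cases type]:
  fixes M :: "'b::zero^2^2"
  obtains a b c d where "M = mat2 a b c d"
proof
  show "M = mat2 (M $ 1 $ 1) (M $ 1 $ 2) (M $ 2 $ 1) (M $ 2 $ 2)"
    by (simp add: vec_eq_iff forall_2)
qed

lemma (in -) mat2_mult [simp]:
  fixes a :: "'b::semiring_1"
  shows "mat2 a b c d ** mat2 a' b' c' d' =
    mat2 (a * a' + b * c') (a * b' + b * d') (c * a' + d * c') (c * b' + d * d')"
  by (simp add: vec_eq_iff forall_2 matrix_matrix_mult_def sum_2)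

lemma (in -) mat_eq_mat2: "(mat k :: 'b::zero^2^2) = mat2 k 0 0 k"
  by (simp add: vec_eq_iff forall_2 mat_def)

lemma (in -) det_mat2 [simp]: "det (mat2 a b c d) = a * d - b * (c::'b::comm_ring_1)"
  by (simp add: det_2)

lemma (in -) trace_mat2 [simp]: "trace (mat2 a b c d) = a + (d::'b::comm_ring_1)"
  by (simp add: trace_def sum_2)

lemma mem_GL2_mat2:
  "mat2 a b c d \<in> GL2_integers v \<longleftrightarrow>
     v a \<le> 1 \<and> v b \<le> 1 \<and> v c \<le> 1 \<and> v d \<le> 1 \<and> v (a * d - b * c) = 1"
  (is "?L \<longleftrightarrow> ?R")
proof
  assume ?L
  then obtain B where A: "v a \<le> 1" "v b \<le> 1" "v c \<le> 1" "v d \<le> 1"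
    and B: "\<forall>i j. B $ i $ j \<in> integers v" and AB: "mat2 a b c d ** B = mat 1"
    by (auto simp: GL2_integers_def forall_2 mem_integers)
  have "v (det B) \<le> 1" "v (a * d - b * c) \<le> 1"
    using A B by (auto simp: det_2 mem_integers intro!: v_diff_le v_mult_le_1)
  moreover have "det (mat2 a b c d) * det B = 1"
    unfolding det_mul[symmetric] AB by simp
  then have "v ((a * d - b * c) * det B) = 1" by simp
  ultimately have "v (a * d - b * c) = 1" using v_eq_1_of_mult by blast
  with A show ?R by simp
next
  assume R: ?R
  define D where "D = a * d - b * c"
  have D: "D \<noteq> 0" using R by (auto simp: D_def)
  define B where "B = mat2 (d / D) (- b / D) (- c / D) (a / D)"
  have "mat2 a b c d ** B = mat 1" "B ** mat2 a b c d = mat 1"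
    using D unfolding B_def mat2_mult mat_eq_mat2 mat2_eq_iff
    by (simp_all add: field_simps) (simp_all add: D_def algebra_simps)
  moreover have "\<forall>i j. B $ i $ j \<in> integers v"
    using R by (simp add: B_def forall_2 mem_integers v_divide D_def)
  moreover have "\<forall>i j. mat2 a b c d $ i $ j \<in> integers v"
    using R by (simp add: forall_2 mem_integers)
  ultimately show ?L unfolding GL2_integers_def by blast
qed

lemma GL2_mult: "A \<in> GL2_integers v \<Longrightarrow> B \<in> GL2_integers v \<Longrightarrow> A ** B \<in> GL2_integers v"
proof (cases A; cases B)
  fix a b c d a' b' c' d'
  assume *: "A \<in> GL2_integers v" "B \<in> GL2_integers v"
    "A = mat2 a b c d" "B = mat2 a' b' c' d'"
  have "(a * a' + b * c') * (c * b' + d * d') - (a * b' + b * d') * (c * a' + d * c') =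
      (a * d - b * c) * (a' * d' - b' * c')"
    by algebra
  then have "v ((a * a' + b * c') * (c * b' + d * d') - (a * b' + b * d') * (c * a' + d * c')) =
      v (a * d - b * c) * v (a' * d' - b' * c')"
    by (simp add: mult)
  with * show ?thesis
    by (simp add: mem_GL2_mat2 v_add_le v_mult_le_1)
qed

lemma GL2_inverse:
  assumes "A \<in> GL2_integers v"
  obtains B where "B \<in> GL2_integers v" "A ** B = mat 1" "B ** A = mat 1"
  using assms unfolding GL2_integers_def by blast

lemma conj_rel_iff:
  "(A, B) \<in> conj_rel v \<longleftrightarrow> A \<in> GL2_integers v \<and> B \<in> GL2_integers v \<and>
     (\<exists>P \<in> GL2_integers v. B ** P = P ** A)"
proof -
  have "B = P ** A ** matrix_inv P \<longleftrightarrow> B ** P = P ** A" if P: "P \<in> GL2_integers v" for P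
  proof -
    obtain Q where "P ** Q = mat 1" "Q ** P = mat 1" using P by (rule GL2_inverse)
    then have "\<exists>Q. P ** Q = mat 1 \<and> Q ** P = mat 1" by blast
    then have "P ** matrix_inv P = mat 1 \<and> matrix_inv P ** P = mat 1"
      unfolding matrix_inv_def by (rule someI_ex)
    then show ?thesis by (metis matrix_mul_assoc matrix_mul_rid)
  qed
  then show ?thesis by (auto simp: conj_rel_def)
qed

lemma conj_rel_refl: "A \<in> GL2_integers v \<Longrightarrow> (A, A) \<in> conj_rel v"
  unfolding conj_rel_iff
  by (auto intro!: bexI[of _ "mat 1"]) (simp add: mat_eq_mat2 mem_GL2_mat2)

lemma conj_rel_sym:
  assumes "(A, B) \<in> conj_rel v"
  shows "(B, A) \<in> conj_rel v"
proof -
  obtain P where P: "P \<in> GL2_integers v" "B ** P = P ** A"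
    using assms by (auto simp: conj_rel_iff)
  obtain Q where Q: "Q \<in> GL2_integers v" "P ** Q = mat 1" "Q ** P = mat 1"
    using P(1) by (rule GL2_inverse)
  have "A ** Q = Q ** (P ** A) ** Q"
    by (simp add: matrix_mul_assoc Q)
  also have "\<dots> = Q ** B"
    by (simp add: P(2)[symmetric] matrix_mul_assoc[symmetric] Q)
  finally show ?thesis using Q assms by (auto simp: conj_rel_iff)
qed

lemma conj_rel_trans:
  assumes "(A, B) \<in> conj_rel v" "(B, C) \<in> conj_rel v"
  shows "(A, C) \<in> conj_rel v"
proof -
  obtain P R where P: "P \<in> GL2_integers v" "B ** P = P ** A"
    and R: "R \<in> GL2_integers v" "C ** R = R ** B"
    using assms by (auto simp: conj_rel_iff)
  have "R ** P \<in> GL2_integers v" using P R by (simp add: GL2_mult)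
  moreover have "C ** (R ** P) = R ** (B ** P)" by (simp add: matrix_mul_assoc R)
  then have "C ** (R ** P) = (R ** P) ** A" by (simp add: P matrix_mul_assoc)
  ultimately show ?thesis using assms unfolding conj_rel_iff by blast
qed

lemma conj_rel_scalar:
  assumes "(A, B) \<in> conj_rel v" "A = I_mat \<alpha> \<or> B = I_mat \<alpha>"
  shows "A = B"
proof -
  have scalar: "B = I_mat \<alpha>" if AB: "(I_mat \<alpha>, B) \<in> conj_rel v" for B
  proof -
    obtain P where P: "P \<in> GL2_integers v" "B ** P = P ** I_mat \<alpha>"
      using AB by (auto simp: conj_rel_iff)
    obtain Q where Q: "P ** Q = mat 1"
      using P(1) by (rule GL2_inverse)
    have "P ** I_mat \<alpha> = I_mat \<alpha> ** P"
      by (cases P) (simp add: I_mat_def mult.commute)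
    then have "B ** (P ** Q) = I_mat \<alpha> ** (P ** Q)"
      using P(2) by (simp add: matrix_mul_assoc)
    then show ?thesis by (simp add: Q)
  qed
  from assms(2) show ?thesis
    using assms(1) scalar conj_rel_sym by metis
qed

section \<open>The invariants of a non-scalar matrix\<close>

definition primitive :: "'a \<Rightarrow> 'a \<Rightarrow> 'a \<Rightarrow> bool" where
  "primitive x y z \<longleftrightarrow> v x \<le> 1 \<and> v y \<le> 1 \<and> v z \<le> 1 \<and> (v x = 1 \<or> v y = 1 \<or> v z = 1)"

text \<open>The scalar \<open>\<alpha>\<close> plus \<open>\<pi>\<^sup>i\<close> times the traceless matrix with rows \<open>(x, y)\<close> and \<open>(z, - x)\<close>. The
  square of the latter is the scalar \<open>x\<^sup>2 + y z\<close>, called \<open>\<Delta>\<close> above.\<close>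

definition scalar_plus :: "'a \<Rightarrow> nat \<Rightarrow> 'a \<Rightarrow> 'a \<Rightarrow> 'a \<Rightarrow> 'a^2^2" where
  "scalar_plus \<alpha> i x y z = mat2 (\<alpha> + \<pi> ^ i * x) (\<pi> ^ i * y) (\<pi> ^ i * z) (\<alpha> - \<pi> ^ i * x)"

lemma (in -) power_double: "b ^ (2 * i) = b ^ i * (b ^ i :: 'b::monoid_mult)"
  by (simp add: mult_2 power_add)

lemma det_scalar_plus: "det (scalar_plus \<alpha> i x y z) = \<alpha>\<^sup>2 - \<pi> ^ (2 * i) * (x\<^sup>2 + y * z)"
  unfolding scalar_plus_def det_mat2 power_double by algebra

lemma scalar_plus_in_GL2_iff:
  assumes "primitive x y z"
  shows "scalar_plus \<alpha> i x y z \<in> GL2_integers v \<longleftrightarrow>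
    v \<alpha> \<le> 1 \<and> v (\<alpha>\<^sup>2 - \<pi> ^ (2 * i) * (x\<^sup>2 + y * z)) = 1"
proof -
  have le: "v (\<pi> ^ i * t) \<le> 1" if "v t \<le> 1" for t
    using that v_uniformizer_power_le_1 by (simp add: v_mult_le_1 v_power)
  have "v (\<alpha> + \<pi> ^ i * x) \<le> 1 \<longleftrightarrow> v \<alpha> \<le> 1"
    using le[of x] assms v_add_le[of \<alpha> 1 "\<pi> ^ i * x"] v_diff_le[of "\<alpha> + \<pi> ^ i * x" 1 "\<pi> ^ i * x"]
    by (auto simp: primitive_def)
  moreover have "v (\<alpha> - \<pi> ^ i * x) \<le> 1" if "v \<alpha> \<le> 1"
    using le[of x] assms that v_diff_le by (auto simp: primitive_def)
  ultimately show ?thesis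
    using le assms det_scalar_plus[of \<alpha> i x y z]
    unfolding scalar_plus_def mem_GL2_mat2 by (auto simp: primitive_def)
qed

text \<open>The power of \<open>\<pi>\<close> to extract is the one in an entry of largest absolute value.\<close>

lemma primitive_factorization:
  assumes "v a \<le> 1" "v b \<le> 1" "v c \<le> 1" "\<not> (a = 0 \<and> b = 0 \<and> c = 0)"
  obtains i x y z where "a = \<pi> ^ i * x" "b = \<pi> ^ i * y" "c = \<pi> ^ i * z" "primitive x y z"
proof -
  define m where "m = Max {v a, v b, v c}"
  have "m \<in> {v a, v b, v c}" unfolding m_def by (rule Max_in) simp_all
  moreover have m: "v a \<le> m" "v b \<le> m" "v c \<le> m" by (simp_all add: m_def)
  ultimately obtain t where t: "t \<in> {a, b, c}" "m = v t" by auto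
  have "t \<noteq> 0"
    using m t assms(4) nonneg[of a] nonneg[of b] nonneg[of c] by (auto simp: eq_0_iff)
  moreover have "v t \<le> 1" using t assms by auto
  ultimately obtain i u where u: "t = \<pi> ^ i * u" "v u = 1"
    using uniformizer_factorization by blast
  have pos: "0 < v \<pi> ^ i" using v_uniformizer_pos by simp
  have "m = v \<pi> ^ i" using u t by (simp add: mult v_power)
  with pos have "0 < m" "v (s / \<pi> ^ i) = v s / m" for s
    by (simp_all add: v_divide v_power)
  with m t have "primitive (a / \<pi> ^ i) (b / \<pi> ^ i) (c / \<pi> ^ i)"
    by (auto simp: primitive_def divide_le_eq_1)
  then show ?thesis by (rule that[of i, rotated 3]) simp_all
qed

lemma nonscalar_eq_scalar_plus:
  assumes A: "A \<in> GL2_integers v" and nonscalar: "\<And>\<alpha>. A \<noteq> I_mat \<alpha>"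
  obtains \<alpha> i x y z where "primitive x y z" "A = scalar_plus \<alpha> i x y z"
proof (cases A)
  fix a b c d
  assume Am: "A = mat2 a b c d"
  have le: "v ((a - d) / 2) \<le> 1" "v b \<le> 1" "v c \<le> 1"
    using A by (auto simp: Am mem_GL2_mat2 v_divide v_diff_le)
  have "\<not> ((a - d) / 2 = 0 \<and> b = 0 \<and> c = 0)"
    using nonscalar[of a] by (auto simp: Am I_mat_def)
  then obtain i x y z where *: "(a - d) / 2 = \<pi> ^ i * x" "b = \<pi> ^ i * y" "c = \<pi> ^ i * z"
    "primitive x y z"
    using primitive_factorization[OF le] by metis
  have "A = scalar_plus ((a + d) / 2) i x y z"
    unfolding Am scalar_plus_def *(1)[symmetric] *(2,3)
    by (simp add: add_divide_distrib[symmetric] diff_divide_distrib[symmetric])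
  with * that show ?thesis by blast
qed

text \<open>The columns of the conjugating matrix are a vector \<open>w\<close> and its image \<open>X w\<close> under the traceless
  part \<open>X\<close>. Such a basis of \<open>\<O>\<^sup>2\<close> exists because \<open>X\<close> modulo \<open>\<pi>\<close> is nonzero and traceless, and hence,
  as \<open>2\<close> is invertible, not scalar: one of the vectors \<open>(1, 0)\<close>, \<open>(0, 1)\<close>, \<open>(1, 1)\<close> is not an
  eigenvector.\<close>

lemma conj_companion:
  assumes prim: "primitive x y z" and A: "scalar_plus \<alpha> i x y z \<in> GL2_integers v"
  shows "(scalar_plus \<alpha> i 0 (x\<^sup>2 + y * z) 1, scalar_plus \<alpha> i x y z) \<in> conj_rel v"
proof -
  have le: "v x \<le> 1" "v y \<le> 1" "v z \<le> 1" using prim by (auto simp: primitive_def)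
  have "\<exists>p q. v p \<le> 1 \<and> v q \<le> 1 \<and> v (p * (z * p - x * q) - (x * p + y * q) * q) = 1"
  proof (cases "v z = 1 \<or> v y = 1")
    case True
    then show ?thesis
    proof
      assume "v z = 1"
      then show ?thesis by (intro exI[of _ 1] exI[of _ 0]) simp
    next
      assume "v y = 1"
      then show ?thesis by (intro exI[of _ 0] exI[of _ 1]) simp
    qed
  next
    case False
    then have "v x = 1" "v z < 1" "v y < 1" using prim by (auto simp: primitive_def)
    then have "v (- (2 * x) + (z - y)) = 1"
      using v_add_dominant[of "z - y" "- (2 * x)"] v_diff_less[of z 1 y] by (simp add: mult)
    moreover have "- (2 * x) + (z - y) = 1 * (z * 1 - x * 1) - (x * 1 + y * 1) * 1" by simp
    ultimately show ?thesis by (metis order.refl v_1)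
  qed
  then obtain p q where pq: "v p \<le> 1" "v q \<le> 1"
    "v (p * (z * p - x * q) - (x * p + y * q) * q) = 1" by blast
  define P where "P = mat2 p (x * p + y * q) q (z * p - x * q)"
  have "P \<in> GL2_integers v"
    using pq le by (simp add: P_def mem_GL2_mat2 v_add_le v_diff_le v_mult_le_1)
  moreover have "scalar_plus \<alpha> i x y z ** P = P ** scalar_plus \<alpha> i 0 (x\<^sup>2 + y * z) 1"
    unfolding P_def scalar_plus_def mat2_mult mat2_eq_iff
    by (simp add: algebra_simps power2_eq_square)
  moreover have "primitive 0 (x\<^sup>2 + y * z) 1"
    using le by (simp add: primitive_def power2_eq_square v_add_le v_mult_le_1)
  then have "scalar_plus \<alpha> i 0 (x\<^sup>2 + y * z) 1 \<in> GL2_integers v"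
    using A prim by (simp add: scalar_plus_in_GL2_iff)
  ultimately show ?thesis using A by (auto simp: conj_rel_iff)
qed

text \<open>Multiplication by matrices over \<open>\<O>\<close> preserves divisibility of all entries by \<open>\<pi>\<^sup>j\<close>. As conjugate
  matrices have conjugate traceless parts, \<open>\<pi>\<^sup>j\<close> divides the entries of \<open>\<pi>\<^sup>i\<close> times a primitive
  matrix. Equal scalar parts may be assumed, since the trace determines them.\<close>

lemma conj_imp_exponent_le:
  assumes prim: "primitive x y z" "primitive x' y' z'"
    and conj: "(scalar_plus \<alpha> i x y z, scalar_plus \<alpha> j x' y' z') \<in> conj_rel v"
  shows "j \<le> i"
proof -
  let ?X = "mat2 (\<pi> ^ i * x) (\<pi> ^ i * y) (\<pi> ^ i * z) (- (\<pi> ^ i * x))"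
  let ?Y = "mat2 (\<pi> ^ j * x') (\<pi> ^ j * y') (\<pi> ^ j * z') (- (\<pi> ^ j * x'))"
  obtain P where P: "P \<in> GL2_integers v"
    "scalar_plus \<alpha> j x' y' z' ** P = P ** scalar_plus \<alpha> i x y z"
    using conj by (auto simp: conj_rel_iff)
  obtain Q where Q: "Q \<in> GL2_integers v" "Q ** P = mat 1"
    using P(1) by (rule GL2_inverse)
  have "?Y ** P = P ** ?X"
    using P(2) by (cases P) (auto simp: scalar_plus_def algebra_simps)
  then have X: "?X = Q ** (?Y ** P)"
    by (metis Q(2) matrix_mul_assoc matrix_mul_lid)
  obtain p q r s where Pm: "P = mat2 p q r s" by (cases P)
  obtain p' q' r' s' where Qm: "Q = mat2 p' q' r' s'" by (cases Q)
  have scale: "v (a * t) \<le> v \<pi> ^ j" "v (t * a) \<le> v \<pi> ^ j"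
    if "v a \<le> 1" "v t \<le> v \<pi> ^ j" for a t
    using that nonneg mult_mono[of "v a" 1 "v t" "v \<pi> ^ j"]
      v_uniformizer_pos by (simp_all add: mult mult.commute)
  have entries: "v (\<pi> ^ j * x') \<le> v \<pi> ^ j" "v (\<pi> ^ j * y') \<le> v \<pi> ^ j" "v (\<pi> ^ j * z') \<le> v \<pi> ^ j"
    using prim(2) by (auto simp: primitive_def v_power intro!: scale(2))
  have le: "v p \<le> 1" "v q \<le> 1" "v r \<le> 1" "v s \<le> 1" "v p' \<le> 1" "v q' \<le> 1" "v r' \<le> 1" "v s' \<le> 1"
    using P(1) Q(1) unfolding Pm Qm mem_GL2_mat2 by simp_all
  have "v (\<pi> ^ i * x) \<le> v \<pi> ^ j" "v (\<pi> ^ i * y) \<le> v \<pi> ^ j" "v (\<pi> ^ i * z) \<le> v \<pi> ^ j"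
    using X unfolding Pm Qm mat2_mult mat2_eq_iff
    by (auto simp: v_add_le v_diff_le scale entries le)
  then have "v \<pi> ^ i \<le> v \<pi> ^ j"
    using prim(1) by (auto simp: primitive_def mult v_power)
  then show ?thesis by (simp add: v_uniformizer_power_le_iff)
qed

text \<open>The trace and the determinant are invariant under conjugation, and so is the largest power of
  \<open>\<pi>\<close> dividing the traceless part. Conversely, all matrices with the same invariants are conjugate to
  the same companion matrix.\<close>

lemma conj_iff_same_invariants:
  assumes prim: "primitive x y z" "primitive x' y' z'"
    and GL2: "scalar_plus \<alpha> i x y z \<in> GL2_integers v" "scalar_plus \<alpha>' j x' y' z' \<in> GL2_integers v"
  shows "(scalar_plus \<alpha> i x y z, scalar_plus \<alpha>' j x' y' z') \<in> conj_rel v \<longleftrightarrow>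
    \<alpha> = \<alpha>' \<and> i = j \<and> x\<^sup>2 + y * z = x'\<^sup>2 + y' * z'"
    (is "(?A, ?B) \<in> _ \<longleftrightarrow> _")
proof
  assume conj: "(?A, ?B) \<in> conj_rel v"
  then obtain P where P: "P \<in> GL2_integers v" "?B ** P = P ** ?A"
    by (auto simp: conj_rel_iff)
  obtain Q where Q: "P ** Q = mat 1" "Q ** P = mat 1"
    using P(1) by (rule GL2_inverse)
  have B: "?B = P ** ?A ** Q"
    by (metis P(2) Q(1) matrix_mul_assoc matrix_mul_rid)
  have "trace ?B = trace (Q ** (P ** ?A))"
    unfolding B by (rule trace_mul_sym)
  then have "trace ?B = trace ?A"
    by (simp add: matrix_mul_assoc Q(2))
  then have "2 * \<alpha>' = 2 * \<alpha>"
    by (simp add: scalar_plus_def)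
  then have \<alpha>: "\<alpha>' = \<alpha>" by simp
  have ij: "i = j"
    using conj_imp_exponent_le prim conj conj_rel_sym unfolding \<alpha> by (metis antisym)
  have "det P * det Q = 1" by (simp add: det_mul[symmetric] Q(1))
  then have "det ?B = det ?A"
    by (simp add: B det_mul mult.commute mult.left_commute)
  then have "\<pi> ^ (2 * i) * (x\<^sup>2 + y * z) = \<pi> ^ (2 * i) * (x'\<^sup>2 + y' * z')"
    unfolding det_scalar_plus \<alpha> ij by simp
  then have "x\<^sup>2 + y * z = x'\<^sup>2 + y' * z'" by simp
  with \<alpha> ij show "\<alpha> = \<alpha>' \<and> i = j \<and> x\<^sup>2 + y * z = x'\<^sup>2 + y' * z'" by simp
next
  assume same: "\<alpha> = \<alpha>' \<and> i = j \<and> x\<^sup>2 + y * z = x'\<^sup>2 + y' * z'"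
  show "(?A, ?B) \<in> conj_rel v"
    using conj_rel_trans[OF conj_rel_sym[OF conj_companion[OF prim(1) GL2(1)]]]
      conj_companion[OF prim(2) GL2(2)] same by simp
qed

end

section \<open>The classification\<close>

locale odd_local_field_nonsquare = odd_local_field v \<pi>
  for v :: "'a::field \<Rightarrow> real" and \<pi> :: 'a +
  fixes \<epsilon> :: 'a
  assumes v_eps [simp]: "v \<epsilon> = 1"
    and nonsquare: "\<not> (\<exists>x. v x = 1 \<and> \<epsilon> = x\<^sup>2)"
begin

text \<open>\<open>M\<close> is a matrix of one of the three non-scalar shapes with invariants \<open>\<alpha>\<close>, \<open>i\<close> and \<open>\<Delta>\<close>. The
  shape is determined by \<open>\<Delta>\<close>: unipotent if \<open>\<Delta>\<close> is not a unit, elliptic if it is a non-square unit,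
  diagonal if it is a square unit.\<close>

definition normal_form :: "'a^2^2 \<Rightarrow> 'a \<Rightarrow> nat \<Rightarrow> 'a \<Rightarrow> bool" where
  "normal_form M \<alpha> i \<Delta> \<longleftrightarrow>
     (\<exists>\<beta>. v \<beta> \<le> 1 \<and> \<Delta> = \<pi> * \<beta> \<and> M = B_mat \<pi> i \<alpha> \<beta>) \<or>
     (\<exists>\<beta>. v \<beta> = 1 \<and> \<Delta> = \<epsilon> * \<beta>\<^sup>2 \<and> M = C_mat \<pi> \<epsilon> i \<alpha> \<beta>) \<or>
     (\<exists>s. v s = 1 \<and> \<Delta> = s\<^sup>2 \<and> M = D_mat (\<alpha> + \<pi> ^ i * s) (\<alpha> - \<pi> ^ i * s))"

lemma normal_form_cases [consumes 1, case_names unipotent elliptic diagonal]: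
  assumes "normal_form M \<alpha> i \<Delta>"
  obtains \<beta> where "v \<beta> \<le> 1" "\<Delta> = \<pi> * \<beta>" "M = B_mat \<pi> i \<alpha> \<beta>"
  | \<beta> where "v \<beta> = 1" "\<Delta> = \<epsilon> * \<beta>\<^sup>2" "M = C_mat \<pi> \<epsilon> i \<alpha> \<beta>"
  | s where "v s = 1" "\<Delta> = s\<^sup>2" "M = D_mat (\<alpha> + \<pi> ^ i * s) (\<alpha> - \<pi> ^ i * s)"
  using assms unfolding normal_form_def by blast

lemma normal_form_exists:
  assumes "v \<Delta> \<le> 1"
  obtains M where "normal_form M \<alpha> i \<Delta>"
proof (cases "v \<Delta> < 1")
  case True
  then obtain \<beta> where "\<Delta> = \<pi> * \<beta>" "v \<beta> \<le> 1" by (rule uniformizer_dvd)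
  then show ?thesis using that unfolding normal_form_def by blast
next
  case False
  then have "v \<Delta> = 1" using assms by simp
  with v_eps nonsquare show ?thesis
  proof (cases rule: unit_square_or_nonsquare_times_square[of \<epsilon> \<Delta>])
    case (1 s)
    then show ?thesis using that unfolding normal_form_def by blast
  next
    case (2 \<beta>)
    then show ?thesis using that unfolding normal_form_def by blast
  qed
qed

lemma normal_form_scalar_plus:
  assumes "normal_form M \<alpha> i \<Delta>"
  obtains x y z where "primitive x y z" "M = scalar_plus \<alpha> i x y z" "x\<^sup>2 + y * z = \<Delta>"
  using assms
proof (cases rule: normal_form_cases)
  case (unipotent \<beta>)
  then have "primitive 0 (\<pi> * \<beta>) 1"
    using v_uniformizer_less_1 by (simp add: primitive_def v_mult_le_1)
  then show ?thesis
    by (rule that) (simp_all add: unipotent B_mat_def scalar_plus_def)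
next
  case (elliptic \<beta>)
  then have "primitive 0 (\<epsilon> * \<beta>) \<beta>"
    by (simp add: primitive_def mult)
  then show ?thesis
    by (rule that) (simp_all add: elliptic C_mat_def scalar_plus_def power2_eq_square)
next
  case (diagonal s)
  then have "primitive s 0 0" by (simp add: primitive_def)
  then show ?thesis
    by (rule that) (simp_all add: diagonal D_mat_def scalar_plus_def)
qed

lemma v_uniformizer_power_mult_less_1: "v t \<le> 1 \<Longrightarrow> v (\<pi> ^ Suc n * t) < 1"
proof -
  assume t: "v t \<le> 1"
  have "v (\<pi> ^ n * t) \<le> 1"
    using t v_uniformizer_power_le_1 by (intro v_mult_le_1) (simp_all add: v_power)
  then have "v (\<pi> * (\<pi> ^ n * t)) < 1" using v_uniformizer_less_1 by (rule v_mult_less_1[rotated])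
  then show ?thesis by (simp add: mult.assoc)
qed

lemma unipotent_in_GL2_iff:
  assumes "v \<beta> \<le> 1"
  shows "B_mat \<pi> i \<alpha> \<beta> \<in> GL2_integers v \<longleftrightarrow> v \<alpha> = 1"
proof -
  have small: "v (\<pi> ^ Suc (2 * i) * \<beta>) < 1"
    using assms by (rule v_uniformizer_power_mult_less_1)
  have det: "\<alpha> * \<alpha> - \<pi> ^ (i + 1) * \<beta> * \<pi> ^ i = \<alpha>\<^sup>2 - \<pi> ^ Suc (2 * i) * \<beta>"
    unfolding power_add power_Suc power_double power_one_right by algebra
  have "v (\<alpha>\<^sup>2 - \<pi> ^ Suc (2 * i) * \<beta>) = 1 \<longleftrightarrow> v \<alpha> = 1"
  proof
    assume "v (\<alpha>\<^sup>2 - \<pi> ^ Suc (2 * i) * \<beta>) = 1"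
    then have "v (\<alpha>\<^sup>2) = 1"
      using v_add_dominant[of "\<pi> ^ Suc (2 * i) * \<beta>" "\<alpha>\<^sup>2 - \<pi> ^ Suc (2 * i) * \<beta>"] small by simp
    then show "v \<alpha> = 1"
      using nonneg[of \<alpha>] by (simp add: v_power power2_eq_1_iff)
  next
    assume "v \<alpha> = 1"
    then show "v (\<alpha>\<^sup>2 - \<pi> ^ Suc (2 * i) * \<beta>) = 1"
      using v_add_dominant[of "- (\<pi> ^ Suc (2 * i) * \<beta>)" "\<alpha>\<^sup>2"] small by (simp add: v_power)
  qed
  moreover have "v (\<pi> ^ (i + 1) * \<beta>) \<le> 1" "v (\<pi> ^ i) \<le> 1"
    using v_uniformizer_power_mult_less_1[OF assms, of i] v_uniformizer_power_le_1
    by (simp_all add: v_power)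
  ultimately show ?thesis
    unfolding B_mat_def mem_GL2_mat2 det by auto
qed

lemma elliptic_in_GL2_iff:
  assumes "v \<beta> = 1"
  shows "C_mat \<pi> \<epsilon> i \<alpha> \<beta> \<in> GL2_integers v \<longleftrightarrow> elliptic_param v \<pi> \<epsilon> i \<alpha> \<beta>"
proof -
  have det: "\<alpha> * \<alpha> - \<pi> ^ i * \<epsilon> * \<beta> * (\<pi> ^ i * \<beta>) = \<alpha>\<^sup>2 - \<epsilon> * \<beta>\<^sup>2 * \<pi> ^ (2 * i)"
    unfolding power_double by algebra
  have "v (\<pi> ^ i * \<epsilon> * \<beta>) \<le> 1" "v (\<pi> ^ i * \<beta>) \<le> 1"
    using assms v_uniformizer_power_le_1 by (simp_all add: mult v_power)
  then show ?thesis
    unfolding C_mat_def mem_GL2_mat2 det elliptic_param_def mem_integers mem_integer_units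
    using assms by auto
qed

lemma diagonal_in_GL2_iff: "D_mat a d \<in> GL2_integers v \<longleftrightarrow> v a = 1 \<and> v d = 1"
proof
  assume "D_mat a d \<in> GL2_integers v"
  then have "v a \<le> 1" "v d \<le> 1" "v (a * d) = 1" by (simp_all add: D_mat_def mem_GL2_mat2)
  then show "v a = 1 \<and> v d = 1"
    using v_eq_1_of_mult[of a d] v_eq_1_of_mult[of d a] by (simp add: mult.commute)
qed (simp add: D_mat_def mem_GL2_mat2 mult)

lemma diagonal_param_shift:
  assumes "v s = 1" and "D_mat (\<alpha> + \<pi> ^ i * s) (\<alpha> - \<pi> ^ i * s) \<in> GL2_integers v"
  shows "diagonal_param v \<pi> i (\<alpha> + \<pi> ^ i * s) (\<alpha> - \<pi> ^ i * s)"
proof -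
  have "(\<alpha> + \<pi> ^ i * s) - (\<alpha> - \<pi> ^ i * s) = \<pi> ^ i * (2 * s)" by simp
  moreover have "v (2 * s) = 1" using assms(1) by (simp add: mult)
  ultimately show ?thesis
    using assms(2) unfolding diagonal_param_def mem_integer_units diagonal_in_GL2_iff
    by (blast intro: mem_integer_units[THEN iffD2])
qed

text \<open>A non-scalar matrix of the list is a normal form that is invertible over \<open>\<O>\<close>: the conditions
  on the parameters say that the determinant is a unit.\<close>

lemma nonscalar_reps:
  "unipotent_reps v \<pi> \<union> elliptic_reps v \<pi> \<epsilon> \<union> diagonal_reps v \<pi> =
    {M \<in> GL2_integers v. \<exists>\<alpha> i \<Delta>. normal_form M \<alpha> i \<Delta>}"
proof (intro equalityI subsetI)
  fix M
  assume "M \<in> unipotent_reps v \<pi> \<union> elliptic_reps v \<pi> \<epsilon> \<union> diagonal_reps v \<pi>"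
  then consider (B) i \<alpha> \<beta> where "M = B_mat \<pi> i \<alpha> \<beta>" "v \<alpha> = 1" "v \<beta> \<le> 1"
    | (C) i \<alpha> \<beta> where "M = C_mat \<pi> \<epsilon> i \<alpha> \<beta>" "elliptic_param v \<pi> \<epsilon> i \<alpha> \<beta>"
    | (D) i \<alpha> \<delta> where "M = D_mat \<alpha> \<delta>" "diagonal_param v \<pi> i \<alpha> \<delta>"
    unfolding unipotent_reps_def elliptic_reps_def diagonal_reps_def mem_integer_units mem_integers
    by blast
  then show "M \<in> {M \<in> GL2_integers v. \<exists>\<alpha> i \<Delta>. normal_form M \<alpha> i \<Delta>}"
  proof cases
    case B
    then show ?thesis
      unfolding normal_form_def using unipotent_in_GL2_iff by blast
  next
    case C
    then have "v \<beta> = 1" by (simp add: elliptic_param_def mem_integer_units)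
    with C show ?thesis
      unfolding normal_form_def using elliptic_in_GL2_iff by blast
  next
    case D
    then obtain u where u: "v u = 1" "\<alpha> - \<delta> = \<pi> ^ i * u" and units: "v \<alpha> = 1" "v \<delta> = 1"
      by (auto simp: diagonal_param_def mem_integer_units)
    have "\<pi> ^ i * (u / 2) = (\<alpha> - \<delta>) / 2" by (simp add: u)
    then have "M = D_mat ((\<alpha> + \<delta>) / 2 + \<pi> ^ i * (u / 2)) ((\<alpha> + \<delta>) / 2 - \<pi> ^ i * (u / 2))"
      by (simp add: D add_divide_distrib[symmetric] diff_divide_distrib[symmetric])
    moreover have "v (u / 2) = 1" using u by (simp add: v_divide)
    ultimately have "normal_form M ((\<alpha> + \<delta>) / 2) i ((u / 2)\<^sup>2)"
      unfolding normal_form_def by blast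
    moreover have "M \<in> GL2_integers v" using units by (simp add: D diagonal_in_GL2_iff)
    ultimately show ?thesis by blast
  qed
next
  fix M
  assume "M \<in> {M \<in> GL2_integers v. \<exists>\<alpha> i \<Delta>. normal_form M \<alpha> i \<Delta>}"
  then obtain \<alpha> i \<Delta> where GL2: "M \<in> GL2_integers v" and "normal_form M \<alpha> i \<Delta>" by blast
  from this(2) show "M \<in> unipotent_reps v \<pi> \<union> elliptic_reps v \<pi> \<epsilon> \<union> diagonal_reps v \<pi>"
  proof (cases rule: normal_form_cases)
    case (unipotent \<beta>)
    then have "v \<alpha> = 1" using GL2 unipotent_in_GL2_iff by blast
    with unipotent show ?thesis
      unfolding unipotent_reps_def mem_integer_units mem_integers by blast
  next
    case (elliptic \<beta>)
    then have "elliptic_param v \<pi> \<epsilon> i \<alpha> \<beta>" using GL2 elliptic_in_GL2_iff by blast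
    with elliptic show ?thesis unfolding elliptic_reps_def by blast
  next
    case (diagonal s)
    then have "diagonal_param v \<pi> i (\<alpha> + \<pi> ^ i * s) (\<alpha> - \<pi> ^ i * s)"
      using GL2 diagonal_param_shift by blast
    with diagonal show ?thesis unfolding diagonal_reps_def by blast
  qed
qed

lemma conj_normal_forms_iff:
  assumes "normal_form M \<alpha> i \<Delta>" "normal_form N \<alpha>' j \<Delta>'"
    and "M \<in> GL2_integers v" "N \<in> GL2_integers v"
  shows "(M, N) \<in> conj_rel v \<longleftrightarrow> \<alpha> = \<alpha>' \<and> i = j \<and> \<Delta> = \<Delta>'"
proof -
  obtain x y z x' y' z' where "primitive x y z" "M = scalar_plus \<alpha> i x y z" "x\<^sup>2 + y * z = \<Delta>"
    "primitive x' y' z'" "N = scalar_plus \<alpha>' j x' y' z'" "x'\<^sup>2 + y' * z' = \<Delta>'"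
    using assms(1,2) by (metis normal_form_scalar_plus)
  then show ?thesis using conj_iff_same_invariants assms(3,4) by metis
qed

lemma square_neq_eps_square: "v s = 1 \<Longrightarrow> v t = 1 \<Longrightarrow> s\<^sup>2 \<noteq> \<epsilon> * t\<^sup>2"
proof
  assume *: "v s = 1" "v t = 1" "s\<^sup>2 = \<epsilon> * t\<^sup>2"
  then have "t \<noteq> 0" by auto
  with * have "\<epsilon> = (s / t)\<^sup>2" by (simp add: power_divide)
  moreover have "v (s / t) = 1" using * by (simp add: v_divide)
  ultimately show False using nonsquare by blast
qed

text \<open>The only freedom left once the invariants are given is the choice of a square root, of
  \<open>\<Delta> / \<epsilon>\<close> in the elliptic and of \<open>\<Delta>\<close> in the diagonal case.\<close>

lemma normal_form_unique_up_to_symmetry: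
  assumes M: "normal_form M \<alpha> i \<Delta>" and N: "normal_form N \<alpha> i \<Delta>" and GL2: "M \<in> GL2_integers v"
  shows "same_up_to_symmetry v \<pi> \<epsilon> M N"
  using M
proof (cases rule: normal_form_cases)
  case (unipotent \<beta>)
  then have small: "v \<Delta> < 1" using v_uniformizer_less_1 by (simp add: v_mult_less_1)
  from N show ?thesis
  proof (cases rule: normal_form_cases)
    case (unipotent \<beta>')
    with \<open>\<Delta> = \<pi> * \<beta>\<close> \<open>M = B_mat \<pi> i \<alpha> \<beta>\<close> show ?thesis
      by (simp add: same_up_to_symmetry_def)
  qed (use small in \<open>simp_all add: mult v_power\<close>)
next
  case (elliptic \<beta>)
  then have unit: "v \<Delta> = 1" by (simp add: mult v_power)
  from N show ?thesis
  proof (cases rule: normal_form_cases)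
    case (unipotent \<beta>')
    then have "v \<Delta> < 1" using v_uniformizer_less_1 by (simp add: v_mult_less_1)
    with unit show ?thesis by simp
  next
    case (elliptic \<beta>')
    have "\<epsilon> \<noteq> 0" using v_eps by (metis v_0 zero_neq_one)
    with elliptic(2) \<open>\<Delta> = \<epsilon> * \<beta>\<^sup>2\<close> have "\<beta>'\<^sup>2 = \<beta>\<^sup>2" by simp
    then have "\<beta>' = \<beta> \<or> \<beta>' = - \<beta>" by (simp only: power2_eq_iff)
    moreover have "elliptic_param v \<pi> \<epsilon> i \<alpha> \<beta>"
      using GL2 \<open>v \<beta> = 1\<close> \<open>M = C_mat \<pi> \<epsilon> i \<alpha> \<beta>\<close> elliptic_in_GL2_iff by blast
    ultimately show ?thesis
      unfolding same_up_to_symmetry_def \<open>M = C_mat \<pi> \<epsilon> i \<alpha> \<beta>\<close> elliptic(3) by blast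
  next
    case (diagonal s)
    with \<open>v \<beta> = 1\<close> \<open>\<Delta> = \<epsilon> * \<beta>\<^sup>2\<close> square_neq_eps_square show ?thesis by metis
  qed
next
  case (diagonal s)
  then have unit: "v \<Delta> = 1" by (simp add: v_power)
  from N show ?thesis
  proof (cases rule: normal_form_cases)
    case (unipotent \<beta>')
    then have "v \<Delta> < 1" using v_uniformizer_less_1 by (simp add: v_mult_less_1)
    with unit show ?thesis by simp
  next
    case (elliptic \<beta>')
    with \<open>v s = 1\<close> \<open>\<Delta> = s\<^sup>2\<close> square_neq_eps_square show ?thesis by metis
  next
    case (diagonal s')
    with \<open>\<Delta> = s\<^sup>2\<close> have "s' = s \<or> s' = - s"
      by (simp add: power2_eq_iff)
    moreover have "diagonal_param v \<pi> i (\<alpha> + \<pi> ^ i * s) (\<alpha> - \<pi> ^ i * s)"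
      using GL2 \<open>v s = 1\<close> \<open>M = _\<close> diagonal_param_shift by blast
    moreover have "N = D_mat (\<alpha> - \<pi> ^ i * s) (\<alpha> + \<pi> ^ i * s)" if "s' = - s"
      using that by (simp add: diagonal(3))
    ultimately show ?thesis
      unfolding same_up_to_symmetry_def using \<open>M = _\<close> diagonal(3) by blast
  qed
qed

lemma same_up_to_symmetry_imp_conj:
  assumes "same_up_to_symmetry v \<pi> \<epsilon> M N" "M \<in> GL2_integers v"
  shows "(M, N) \<in> conj_rel v"
proof -
  consider (eq) "M = N"
    | (C) i \<alpha> \<beta> where "elliptic_param v \<pi> \<epsilon> i \<alpha> \<beta>" "M = C_mat \<pi> \<epsilon> i \<alpha> \<beta>" "N = C_mat \<pi> \<epsilon> i \<alpha> (- \<beta>)"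
    | (D) \<alpha> \<delta> where "M = D_mat \<alpha> \<delta>" "N = D_mat \<delta> \<alpha>"
    using assms(1) unfolding same_up_to_symmetry_def by blast
  then show ?thesis
  proof cases
    case eq
    then show ?thesis using assms(2) conj_rel_refl by simp
  next
    case C
    let ?P = "mat2 1 0 0 (- 1)"
    have "N \<in> GL2_integers v"
      using assms(2) unfolding C C_mat_def mem_GL2_mat2 by simp
    moreover have "?P \<in> GL2_integers v" by (simp add: mem_GL2_mat2)
    moreover have "N ** ?P = ?P ** M" by (simp add: C C_mat_def)
    ultimately show ?thesis using assms(2) unfolding conj_rel_iff by blast
  next
    case D
    let ?P = "mat2 0 1 1 0"
    have "N \<in> GL2_integers v"
      using assms(2) unfolding D diagonal_in_GL2_iff by simp
    moreover have "?P \<in> GL2_integers v" by (simp add: mem_GL2_mat2)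
    moreover have "N ** ?P = ?P ** M" by (simp add: D D_mat_def)
    ultimately show ?thesis using assms(2) unfolding conj_rel_iff by blast
  qed
qed

lemma conj_reps_eq:
  "conj_reps v \<pi> \<epsilon> =
    {I_mat \<alpha> | \<alpha>. v \<alpha> = 1} \<union> {M \<in> GL2_integers v. \<exists>\<alpha> i \<Delta>. normal_form M \<alpha> i \<Delta>}"
  unfolding nonscalar_reps[symmetric] by (auto simp: conj_reps_def scalar_reps_def mem_integer_units)

lemma scalar_in_GL2_iff: "I_mat \<alpha> \<in> GL2_integers v \<longleftrightarrow> v \<alpha> = 1"
  using diagonal_in_GL2_iff[of \<alpha> \<alpha>] by (simp add: I_mat_def D_mat_def)

lemma conj_reps_subset_GL2: "conj_reps v \<pi> \<epsilon> \<subseteq> GL2_integers v"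
  by (auto simp: conj_reps_eq scalar_in_GL2_iff)

lemma conj_to_conj_rep:
  assumes A: "A \<in> GL2_integers v"
  obtains M where "M \<in> conj_reps v \<pi> \<epsilon>" "(A, M) \<in> conj_rel v"
proof (cases "\<exists>\<alpha>. A = I_mat \<alpha>")
  case True
  then have "A \<in> conj_reps v \<pi> \<epsilon>" using A by (auto simp: conj_reps_eq scalar_in_GL2_iff)
  with A that conj_rel_refl show ?thesis by blast
next
  case False
  then obtain \<alpha> i x y z where prim: "primitive x y z" and Aeq: "A = scalar_plus \<alpha> i x y z"
    using nonscalar_eq_scalar_plus[OF A] by metis
  have "v (x\<^sup>2 + y * z) \<le> 1"
    using prim by (simp add: primitive_def power2_eq_square v_add_le v_mult_le_1)
  then obtain M where M: "normal_form M \<alpha> i (x\<^sup>2 + y * z)" by (rule normal_form_exists)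
  then obtain x' y' z' where M': "primitive x' y' z'" "M = scalar_plus \<alpha> i x' y' z'"
    "x'\<^sup>2 + y' * z' = x\<^sup>2 + y * z"
    by (rule normal_form_scalar_plus)
  then have GL2: "M \<in> GL2_integers v"
    using A prim by (simp add: Aeq scalar_plus_in_GL2_iff)
  then have "(A, M) \<in> conj_rel v"
    using conj_iff_same_invariants[OF prim M'(1)] A M' unfolding Aeq by metis
  moreover have "M \<in> conj_reps v \<pi> \<epsilon>" using GL2 M by (auto simp: conj_reps_eq)
  ultimately show ?thesis using that by blast
qed

lemma conj_reps_conj_iff:
  assumes M: "M \<in> conj_reps v \<pi> \<epsilon>" and N: "N \<in> conj_reps v \<pi> \<epsilon>"
  shows "(M, N) \<in> conj_rel v \<longleftrightarrow> same_up_to_symmetry v \<pi> \<epsilon> M N"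
proof
  assume conj: "(M, N) \<in> conj_rel v"
  show "same_up_to_symmetry v \<pi> \<epsilon> M N"
  proof (cases "\<exists>\<alpha>. M = I_mat \<alpha> \<or> N = I_mat \<alpha>")
    case True
    then have "M = N" using conj_rel_scalar[OF conj] by blast
    then show ?thesis by (simp add: same_up_to_symmetry_def)
  next
    case False
    then obtain \<alpha> i \<Delta> \<alpha>' j \<Delta>' where nf: "normal_form M \<alpha> i \<Delta>" "normal_form N \<alpha>' j \<Delta>'"
      and GL2: "M \<in> GL2_integers v" "N \<in> GL2_integers v"
      using M N unfolding conj_reps_eq by blast
    then have "\<alpha> = \<alpha>' \<and> i = j \<and> \<Delta> = \<Delta>'" using conj conj_normal_forms_iff by blast
    with nf GL2 show ?thesis using normal_form_unique_up_to_symmetry by blast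
  qed
next
  assume "same_up_to_symmetry v \<pi> \<epsilon> M N"
  then show "(M, N) \<in> conj_rel v"
    using M conj_reps_subset_GL2 same_up_to_symmetry_imp_conj by blast
qed

end

theorem proposition2:
  fixes v :: "'a::field \<Rightarrow> real" and \<pi> \<epsilon> :: 'a
  assumes "nonarch_local_field v"
    and "uniformizer v \<pi>"
    and "residue_char v \<noteq> 2"
    and "\<epsilon> \<in> integer_units v"
    and "\<not> (\<exists>x \<in> integers v. \<epsilon> = x^2)"
  shows "conj_reps v \<pi> \<epsilon> \<subseteq> GL2_integers v \<and>
    (\<forall>K \<in> conj_classes v. \<exists>M \<in> conj_reps v \<pi> \<epsilon>. M \<in> K) \<and>
    (\<forall>M \<in> conj_reps v \<pi> \<epsilon>. \<forall>N \<in> conj_reps v \<pi> \<epsilon>.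
       (M, N) \<in> conj_rel v \<longleftrightarrow> same_up_to_symmetry v \<pi> \<epsilon> M N)"
proof -
  interpret nonarch_local_field v by fact
  interpret odd_local_field_nonsquare v \<pi> \<epsilon>
  proof
    show "v \<epsilon> = 1" using assms(4) by (simp add: mem_integer_units)
    show "\<not> (\<exists>x. v x = 1 \<and> \<epsilon> = x\<^sup>2)" using assms(5) by (auto simp: mem_integers)
  qed fact+
  have "\<exists>M \<in> conj_reps v \<pi> \<epsilon>. M \<in> K" if K: "K \<in> conj_classes v" for K
  proof -
    obtain A where A: "A \<in> GL2_integers v" "K = conj_rel v `` {A}"
      using K unfolding conj_classes_def by (rule quotientE)
    obtain M where "M \<in> conj_reps v \<pi> \<epsilon>" "(A, M) \<in> conj_rel v"
      using A(1) by (rule conj_to_conj_rep)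
    with A(2) show ?thesis by blast
  qed
  with conj_reps_subset_GL2 conj_reps_conj_iff show ?thesis by blast
qed

end
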